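(* Let $N\in\mathbb N$ and let $p$ be a prime divisor of $N$. Let $m\in\mathbb N$ with $2\le m\le p-1$. Let $n\in\mathbb N$ and $r\in\{1,\ldots,m-1\}$ be such that $p=mn+r$. Let $(a,b)\in\mathbb Z^2$. Then the following properties hold. (1) There exist unique integers $d_{i,j}\in p\cdot\{0,1,\ldots,\frac{N-p}p\}=\{0,p,2p,\ldots,N-p\}$ indexed by $(i,j)\in\mathbb I_{m,r}$ such that in $\mathbb Z[X,Y]$ $$(X+Y+b)^N-\bigl(X^p+Y^p+(b+a)^p-a\bigr)^{\frac Np}\equiv\sum_{(i,j)\in\mathbb I_{m,r}}d_{i,j}X^iY^j\pmod{J_{m,r,N;a}}.$$ (2) For these integers we also have in $\mathbb Z[X,Y]$ $$(X+Y+b)^N-(b+a)^N\equiv\sum_{(i,j)\in\mathbb I_{m,r}}d_{i,j}X^iY^j\pmod{I_{m,r,N;a}}.$$ (3) If $(X+Y+b)^N-(b+a)^N\notin I_{m,r,N;a}$, then there exists a pair $(i_0,j_0)\in\mathbb I_{m,r}$ such that $d_{i_0,j_0}\ne0$ (so $\gcd(d_{i_0,j_0},N)$ is a proper divisor of $N$).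
   Context: $\mathbb N$ is the set of positive integers. $\mathbb I_{m,r}:=\{0,\ldots,m-1\}\times\{0,\ldots,r-1\}$. Ideals of $\mathbb Z[X,Y]$: $I_{m,r,N;a}:=(X^m-1,Y^m-1,X^r+Y^r-a,N)$ and $J_{m,r,N;a}:=(X^m-1,X^r+Y^r-a,N)$. A proper divisor of $N$ is a divisor different from $1$ and $N$. *)

theory Defs
  imports "HOL-Computational_Algebra.Computational_Algebra"
begin

text \<open>
  The ring \<open>\<int>[X,Y]\<close> is rendered as \<open>\<int>[X][Y]\<close>, that is, as the type \<^typ>\<open>int poly poly\<close>; the
  outer variable is \<open>Y\<close>. Integer constants are embedded by \<^const>\<open>of_int\<close> and \<^const>\<open>of_nat\<close>.
\<close>

definition varX :: "int poly poly" where
  "varX = [:[:0, 1:]:]"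

definition varY :: "int poly poly" where
  "varY = [:0, 1:]"

text \<open>The ideal generated by a set is its span in the ring viewed as a module over itself.\<close>

definition ideal_gen :: "'a::comm_ring_1 set \<Rightarrow> 'a set" where
  "ideal_gen S = module.span (*) S"

definition ideal_cong :: "'a::comm_ring_1 set \<Rightarrow> 'a \<Rightarrow> 'a \<Rightarrow> bool" where
  "ideal_cong I f g \<longleftrightarrow> f - g \<in> I"

definition idealI :: "nat \<Rightarrow> nat \<Rightarrow> nat \<Rightarrow> int \<Rightarrow> int poly poly set" where
  "idealI m r N a =
     ideal_gen {varX ^ m - 1, varY ^ m - 1, varX ^ r + varY ^ r - of_int a, of_nat N}"

definition idealJ :: "nat \<Rightarrow> nat \<Rightarrow> nat \<Rightarrow> int \<Rightarrow> int poly poly set" where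
  "idealJ m r N a = ideal_gen {varX ^ m - 1, varX ^ r + varY ^ r - of_int a, of_nat N}"

definition index_set :: "nat \<Rightarrow> nat \<Rightarrow> (nat \<times> nat) set" where
  "index_set m r = {0..<m} \<times> {0..<r}"

definition coeff_poly :: "nat \<Rightarrow> nat \<Rightarrow> (nat \<times> nat \<Rightarrow> int) \<Rightarrow> int poly poly" where
  "coeff_poly m r d = (\<Sum>(i, j)\<in>index_set m r. of_int (d (i, j)) * varX ^ i * varY ^ j)"

text \<open>
  The division is exact whenever \<open>p\<close> divides \<open>N\<close>. Families are extensional (\<^const>\<open>PiE\<close>), so that
  equality of families means equality of the integers indexed by \<^const>\<open>index_set\<close>.
\<close>

definition coeff_families :: "nat \<Rightarrow> nat \<Rightarrow> nat \<Rightarrow> nat \<Rightarrow> (nat \<times> nat \<Rightarrow> int) set" where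
  "coeff_families m r p N =
     index_set m r \<rightarrow>\<^sub>E (\<lambda>k. int p * k) ` {0..(int N - int p) div int p}"

definition proper_divisor :: "int \<Rightarrow> int \<Rightarrow> bool" where
  "proper_divisor d N \<longleftrightarrow> 0 < d \<and> d dvd N \<and> d \<noteq> 1 \<and> d \<noteq> N"

lemma module_times: "module ((*) :: 'a::comm_ring_1 \<Rightarrow> 'a \<Rightarrow> 'a)"
  by unfold_locales (simp_all add: algebra_simps)

lemma ideal_gen_explicit:
  "ideal_gen S = {\<Sum>s\<in>T. c s * s | T c. finite T \<and> T \<subseteq> S}"
  unfolding ideal_gen_def by (rule module.span_explicit[OF module_times])

end

theory Submission
  imports Defs
begin

text \<open>
  Modulo \<open>p\<close> the Frobenius map and Fermat's little theorem make the left-hand side of (1)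
  vanish, so it equals \<open>p\<close> times some \<open>E\<close>. Since \<open>X\<^sup>m - 1\<close> is monic in \<open>X\<close> and
  \<open>X\<^sup>r + Y\<^sup>r - a\<close> is monic in \<open>Y\<close>, division with remainder shows that the monomials
  \<open>X\<^sup>i Y\<^sup>j\<close> with \<open>i < m\<close>, \<open>j < r\<close> form a basis of \<open>\<int>[X,Y]/J\<close> over \<open>\<int>/N\<close>; dividing \<open>E\<close> and
  reducing its coefficients modulo \<open>N/p\<close> gives (1). In (2), \<open>p \<equiv> r\<close> modulo \<open>m\<close> turns
  \<open>X\<^sup>p + Y\<^sup>p - a\<close> into \<open>X\<^sup>r + Y\<^sup>r - a\<close>, which lies in \<open>I\<close>.
\<close>

section \<open>Congruences modulo a generated ideal\<close>

lemma ideal_gen_add: "f \<in> ideal_gen S \<Longrightarrow> g \<in> ideal_gen S \<Longrightarrow> f + g \<in> ideal_gen S"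
  unfolding ideal_gen_def by (rule module.span_add[OF module_times])

lemma ideal_gen_diff: "f \<in> ideal_gen S \<Longrightarrow> g \<in> ideal_gen S \<Longrightarrow> f - g \<in> ideal_gen S"
  unfolding ideal_gen_def by (rule module.span_diff[OF module_times])

lemma ideal_gen_mult: "f \<in> ideal_gen S \<Longrightarrow> c * f \<in> ideal_gen S"
  unfolding ideal_gen_def by (rule module.span_scale[OF module_times])

lemma ideal_gen_base: "f \<in> S \<Longrightarrow> f \<in> ideal_gen S"
  unfolding ideal_gen_def by (rule module.span_base[OF module_times])

lemma ideal_gen_mono: "S \<subseteq> T \<Longrightarrow> ideal_gen S \<subseteq> ideal_gen T"
  unfolding ideal_gen_def by (rule module.span_mono[OF module_times])

text \<open>Applied repeatedly, this peels off generators one at a time and so yields explicit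
  multipliers for an element of the ideal.\<close>

lemma ideal_gen_insert_iff: "f \<in> ideal_gen (insert s S) \<longleftrightarrow> (\<exists>c. f - c * s \<in> ideal_gen S)"
  unfolding ideal_gen_def by (rule module.span_breakdown_eq[OF module_times])

lemma ideal_gen_empty: "ideal_gen {} = {0}"
  unfolding ideal_gen_def by (rule module.span_empty[OF module_times])

lemma ideal_cong_trans:
  "ideal_cong (ideal_gen S) f g \<Longrightarrow> ideal_cong (ideal_gen S) g h \<Longrightarrow> ideal_cong (ideal_gen S) f h"
  using ideal_gen_add[of "f - g" S "g - h"] by (simp add: ideal_cong_def)

lemma ideal_cong_add:
  "ideal_cong (ideal_gen S) f g \<Longrightarrow> ideal_cong (ideal_gen S) f' g' \<Longrightarrow>
    ideal_cong (ideal_gen S) (f + f') (g + g')"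
  using ideal_gen_add[of "f - g" S "f' - g'"] by (simp add: ideal_cong_def algebra_simps)

lemma ideal_cong_mult_left:
  "ideal_cong (ideal_gen S) f g \<Longrightarrow> ideal_cong (ideal_gen S) (h * f) (h * g)"
  using ideal_gen_mult[of "f - g" S h] by (simp add: ideal_cong_def algebra_simps)

lemma diff_dvd_power_diff: "(f - g :: 'a::comm_ring_1) dvd f ^ k - g ^ k"
  unfolding power_diff_sumr2 by (rule dvd_triv_left)

lemma ideal_cong_power:
  assumes "ideal_cong (ideal_gen S) f g"
  shows "ideal_cong (ideal_gen S) (f ^ k) (g ^ k)"
proof -
  obtain c where "f ^ k - g ^ k = c * (f - g)"
    using diff_dvd_power_diff[of f g k] by (metis dvdE mult.commute)
  then show ?thesis
    using assms ideal_gen_mult[of "f - g" S c] by (simp add: ideal_cong_def)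
qed

section \<open>Prime powers modulo a prime\<close>

text \<open>In the binomial expansion only the two end terms survive modulo \<open>p\<close>, since
  \<open>p\<close> divides every inner binomial coefficient.\<close>

lemma prime_dvd_add_power_diff:
  fixes x y :: "'a::comm_ring_1"
  assumes "prime p"
  shows "of_nat p dvd (x + y) ^ p - (x ^ p + y ^ p)"
proof -
  let ?t = "\<lambda>k. of_nat (p choose k) * x ^ k * y ^ (p - k)"
  have "{..p} = insert 0 (insert p {0<..<p})"
    by auto
  then have "(x + y) ^ p - (x ^ p + y ^ p) = sum ?t {0<..<p}"
    using prime_gt_0_nat[OF assms] by (simp add: binomial_ring)
  also have "of_nat p dvd \<dots>"
  proof (rule dvd_sum)
    fix k assume "k \<in> {0<..<p}"
    then have "p dvd p choose k"
      using assms by (intro dvd_choose_prime) auto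
    then show "of_nat p dvd ?t k"
      by (elim dvdE) (simp add: mult.assoc)
  qed
  finally show ?thesis .
qed

text \<open>Fermat's little theorem: the Frobenius congruence with second summand 1 passes between
  consecutive integers, so induction runs in both directions from 0.\<close>

lemma prime_dvd_int_power_diff:
  fixes k :: int
  assumes "prime p"
  shows "int p dvd k ^ p - k"
proof (induction k rule: int_induct[where k = 0])
  case base
  then show ?case using prime_gt_0_nat[OF assms] by (simp add: power_0_left)
next
  case (step1 i)
  then show ?case
    using dvd_add[OF prime_dvd_add_power_diff[OF assms, of i 1] step1(2)]
    by (simp add: algebra_simps)
next
  case (step2 i)
  then show ?case
    using dvd_diff[OF step2(2) prime_dvd_add_power_diff[OF assms, of "i - 1" 1]]
    by (simp add: algebra_simps)
qed

lemma of_nat_dvd_of_int: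
  assumes "int p dvd k"
  shows "of_nat p dvd (of_int k :: 'a::comm_ring_1)"
  using assms by (elim dvdE) simp

lemma prime_dvd_trinomial_power_diff:
  fixes x y :: "'a::comm_ring_1"
  assumes "prime p" "p dvd N"
  shows "of_nat p dvd (x + y + of_int b) ^ N
    - (x ^ p + y ^ p + of_int (b + a) ^ p - of_int a) ^ (N div p)"
proof -
  have "of_nat p dvd (of_int (b - (b + a) ^ p + a) :: 'a)"
  proof -
    have "int p dvd b - (b + a) ^ p + a"
      using prime_dvd_int_power_diff[OF assms(1), of "b + a"]
      by (subst dvd_minus_iff[symmetric]) (simp add: algebra_simps)
    then show ?thesis
      by (rule of_nat_dvd_of_int)
  qed
  moreover have "of_nat p dvd (of_int (b ^ p - b) :: 'a)"
    by (intro of_nat_dvd_of_int prime_dvd_int_power_diff assms(1))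
  moreover note prime_dvd_add_power_diff[OF assms(1), of x y]
    prime_dvd_add_power_diff[OF assms(1), of "x + y" "of_int b"]
  \<comment> \<open>The four summands telescope: split off \<open>b\<close>, split
    \<open>x + y\<close>, replace \<open>b ^ p\<close> by \<open>b\<close>, then replace
    \<open>b\<close> by \<open>(b + a) ^ p - a\<close>.\<close>
  ultimately have "of_nat p dvd ((x + y + of_int b) ^ p - ((x + y) ^ p + of_int b ^ p))
      + ((x + y) ^ p - (x ^ p + y ^ p)) + of_int (b ^ p - b) + of_int (b - (b + a) ^ p + a)"
    by (intro dvd_add)
  then have "of_nat p dvd (x + y + of_int b) ^ p - (x ^ p + y ^ p + of_int (b + a) ^ p - of_int a)"
    by (simp add: algebra_simps)
  then have "of_nat p dvd ((x + y + of_int b) ^ p) ^ (N div p)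
      - (x ^ p + y ^ p + of_int (b + a) ^ p - of_int a) ^ (N div p)"
    using diff_dvd_power_diff by (rule dvd_trans)
  then show ?thesis
    using assms(2) by (simp flip: power_mult)
qed

section \<open>Reduced representatives modulo the ideal\<close>

text \<open>Pseudo-division multiplies the dividend by a power of the leading coefficient, here 1,
  so it is true division over any domain. Bounding the remainder through its coefficients covers a
  zero remainder without a separate case.\<close>

lemma monic_division:
  fixes f g :: "'a::idom poly"
  assumes "lead_coeff g = 1"
  obtains q h where "f = g * q + h" "\<And>k. k \<ge> degree g \<Longrightarrow> coeff h k = 0"
proof -
  obtain q h where *: "pseudo_divmod f g = (q, h)"
    by fastforce
  have "g \<noteq> 0"
    using assms by auto
  from pseudo_divmod[OF this *] assms show thesis
    by (intro that[of q h]) (auto simp: coeff_eq_0)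
qed

text \<open>A nonzero multiple of \<open>g\<close> has degree at least that of \<open>g\<close>, so
  its leading coefficient would be among those assumed to vanish.\<close>

lemma monic_dvd_reduced_eq_0:
  fixes f g :: "'a::idom poly"
  assumes "lead_coeff g = 1" "g dvd f" "\<And>k. k \<ge> degree g \<Longrightarrow> coeff f k = 0"
  shows "f = 0"
  using assms by (metis dvd_imp_degree_le leading_coeff_0_iff)

lemma varX_power: "varX ^ i = [:monom 1 i:]"
  by (simp add: varX_def poly_const_pow monom_altdef)

lemma varY_power: "varY ^ j = monom 1 j"
  by (simp add: varY_def monom_altdef)

lemma coeff_coeff_poly:
  "coeff (coeff (coeff_poly m r d) j) i = (if (i, j) \<in> index_set m r then d (i, j) else 0)"
proof -
  have "coeff (coeff (coeff_poly m r d) j) i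
      = (\<Sum>k\<in>index_set m r. if k = (i, j) then d (i, j) else 0)"
    unfolding coeff_poly_def coeff_sum
    by (intro sum.cong)
      (auto simp: varX_power varY_power of_int_poly smult_monom split: if_splits)
  also have "\<dots> = (if (i, j) \<in> index_set m r then d (i, j) else 0)"
    by (simp add: index_set_def)
  finally show ?thesis .
qed

lemma coeff_poly_eqI:
  assumes "\<And>i j. (i, j) \<notin> index_set m r \<Longrightarrow> coeff (coeff f j) i = 0"
  shows "coeff_poly m r (\<lambda>(i, j). coeff (coeff f j) i) = f"
  by (intro poly_eqI) (use assms in \<open>auto simp: coeff_coeff_poly\<close>)

lemma monic_X:
  assumes "m > 0"
  shows "degree (monom 1 m - 1 :: int poly) = m" "lead_coeff (monom 1 m - 1 :: int poly) = 1"
proof -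
  have "degree (monom 1 m - 1 :: int poly) \<le> m"
    by (intro degree_diff_le) (auto simp: degree_monom_le)
  moreover have "coeff (monom 1 m - 1 :: int poly) m = 1"
    using assms by simp
  ultimately show "degree (monom 1 m - 1 :: int poly) = m"
    by (metis le_degree order_antisym zero_neq_one)
  then show "lead_coeff (monom 1 m - 1 :: int poly) = 1"
    using assms by simp
qed

text \<open>As a polynomial in \<open>Y\<close>, both \<open>varX ^ r\<close> and \<open>a\<close>
  are constants; \<open>r > 0\<close> keeps them away from the top coefficient.\<close>

lemma monic_Y:
  assumes "r > 0"
  shows "degree (varX ^ r + varY ^ r - of_int a) = r"
    "lead_coeff (varX ^ r + varY ^ r - of_int a) = 1"
proof -
  have "degree (varX ^ r + varY ^ r - of_int a) \<le> r"
    by (intro degree_diff_le degree_add_le) (auto simp: varX_power varY_power degree_monom_le)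
  moreover have c: "coeff (varX ^ r + varY ^ r - of_int a) r = 1"
    using assms by (auto simp: varX_power varY_power of_int_poly coeff_pCons split: nat.split)
  ultimately show "degree (varX ^ r + varY ^ r - of_int a) = r"
    by (metis le_degree order_antisym zero_neq_one)
  then show "lead_coeff (varX ^ r + varY ^ r - of_int a) = 1"
    using c by simp
qed

lemma varX_diff_1: "varX ^ m - 1 = [:monom 1 m - 1:]"
  by (simp add: varX_power one_pCons)

text \<open>Divide twice: first in \<open>Y\<close> by the trinomial, then each coefficient of the
  remainder in \<int>[X] by \<open>monom 1 m - 1\<close>.\<close>

lemma reduced_representative:
  assumes "m > 0" "r > 0"
  obtains e where
    "ideal_cong (ideal_gen {varX ^ m - 1, varX ^ r + varY ^ r - of_int a}) f (coeff_poly m r e)"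
proof -
  let ?x = "monom 1 m - 1 :: int poly" and ?y = "varX ^ r + varY ^ r - of_int a"
  obtain q f0 where f: "f = ?y * q + f0" and f0: "\<And>k. k \<ge> r \<Longrightarrow> coeff f0 k = 0"
    using monic_division[OF monic_Y(2)[OF assms(2)]] monic_Y(1)[OF assms(2)] by metis
  have "\<exists>g h. coeff f0 j = ?x * g + h \<and> (\<forall>k\<ge>m. coeff h k = 0)" for j
    using monic_division[OF monic_X(2)[OF assms(1)]] monic_X(1)[OF assms(1)] by metis
  then obtain g h where gh: "\<And>j. coeff f0 j = ?x * g j + h j" "\<And>j k. k \<ge> m \<Longrightarrow> coeff (h j) k = 0"
    by metis
  \<comment> \<open>These reassemble the coefficientwise quotients and remainders into polynomials
    in \<open>Y\<close>; the sums stop at \<open>r\<close>, from where on \<open>f0\<close> has only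
    zero coefficients.\<close>
  define G H where "G = (\<Sum>j<r. monom (g j) j)" and "H = (\<Sum>j<r. monom (h j) j)"
  have "f0 = G * (varX ^ m - 1) + H"
  proof (rule poly_eqI)
    fix k
    show "coeff f0 k = coeff (G * (varX ^ m - 1) + H) k"
      using f0[of k] gh(1)[of k]
      by (simp add: varX_diff_1 G_def H_def coeff_sum)
  qed
  moreover have "coeff_poly m r (\<lambda>(i, j). coeff (coeff H j) i) = H"
    by (intro coeff_poly_eqI) (auto simp: H_def coeff_sum index_set_def gh(2))
  moreover have "q * ?y + G * (varX ^ m - 1) \<in> ideal_gen {varX ^ m - 1, ?y}"
    by (intro ideal_gen_add ideal_gen_mult ideal_gen_base) auto
  ultimately show thesis
    by (intro that[of "\<lambda>(i, j). coeff (coeff H j) i"]) (simp add: ideal_cong_def f mult.commute)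
qed

text \<open>Linear independence of the reduced monomials modulo \<open>N\<close>. The multipliers of
  the other generators are reduced modulo a monic one; degree then forces the multiple of the monic
  generator to vanish. This is done first in \<open>Y\<close>, then in \<open>X\<close>.\<close>

lemma reduced_in_idealJ_dvd:
  assumes "m > 0" "r > 0" "coeff_poly m r d \<in> idealJ m r N a" "k \<in> index_set m r"
  shows "int N dvd d k"
proof -
  let ?x = "monom 1 m - 1 :: int poly" and ?y = "varX ^ r + varY ^ r - of_int a"
  let ?f = "coeff_poly m r d"
  obtain i j where k: "k = (i, j)"
    by fastforce
  obtain A B C where f: "?f = A * [:?x:] + B * ?y + C * of_nat N"
    using assms(3) unfolding idealJ_def ideal_gen_insert_iff ideal_gen_empty varX_diff_1
    by (force simp: algebra_simps)
  obtain A1 A0 where A: "A = ?y * A1 + A0" "\<And>k. k \<ge> r \<Longrightarrow> coeff A0 k = 0"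
    using monic_division[OF monic_Y(2)[OF assms(2)]] monic_Y(1)[OF assms(2)] by metis
  obtain C1 C0 where C: "C = ?y * C1 + C0" "\<And>k. k \<ge> r \<Longrightarrow> coeff C0 k = 0"
    using monic_division[OF monic_Y(2)[OF assms(2)]] monic_Y(1)[OF assms(2)] by metis
  \<comment> \<open>Since \<open>[:?x:]\<close> and \<open>of_nat N\<close> are constant in
    \<open>Y\<close>, the left side is still reduced in \<open>Y\<close>, yet it is a multiple of
    \<open>?y\<close>.\<close>
  have "?f - A0 * [:?x:] - C0 * of_nat N = 0"
  proof (rule monic_dvd_reduced_eq_0[OF monic_Y(2)[OF assms(2)]])
    have "?f - A0 * [:?x:] - C0 * of_nat N = ?y * (A1 * [:?x:] + B + C1 * of_nat N)"
      unfolding f A(1) C(1) by (simp only: algebra_simps)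
    then show "?y dvd ?f - A0 * [:?x:] - C0 * of_nat N"
      by simp
  next
    fix k assume "k \<ge> degree ?y"
    then have "k \<ge> r"
      by (simp only: monic_Y(1)[OF assms(2)])
    moreover from this have "coeff ?f k = 0"
      by (intro poly_eqI) (simp add: coeff_coeff_poly index_set_def)
    ultimately show "coeff (?f - A0 * [:?x:] - C0 * of_nat N) k = 0"
      using A(2) C(2) by (simp add: of_nat_poly)
  qed
  then have "coeff (?f - A0 * [:?x:] - C0 * of_nat N) j = 0"
    by simp
  then have fj: "coeff ?f j = ?x * coeff A0 j + of_nat N * coeff C0 j"
    by (simp add: of_nat_poly algebra_simps)
  \<comment> \<open>The same argument in \<int>[X] for the coefficient of \<open>varY ^ j\<close>,
    with \<open>?x\<close> as the monic divisor.\<close>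
  obtain D1 D0 where D: "coeff C0 j = ?x * D1 + D0" "\<And>k. k \<ge> m \<Longrightarrow> coeff D0 k = 0"
    using monic_division[OF monic_X(2)[OF assms(1)]] monic_X(1)[OF assms(1)] by metis
  have "coeff ?f j - of_nat N * D0 = 0"
  proof (rule monic_dvd_reduced_eq_0[OF monic_X(2)[OF assms(1)]])
    have "coeff ?f j - of_nat N * D0 = ?x * (coeff A0 j + of_nat N * D1)"
      unfolding fj D(1) by (simp only: algebra_simps)
    then show "?x dvd coeff ?f j - of_nat N * D0"
      by simp
  next
    fix k assume "k \<ge> degree ?x"
    then have "k \<ge> m"
      by (simp only: monic_X(1)[OF assms(1)])
    then show "coeff (coeff ?f j - of_nat N * D0) k = 0"
      using D(2) by (simp add: of_nat_poly coeff_coeff_poly index_set_def)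
  qed
  then have "coeff (coeff ?f j - of_nat N * D0) i = 0"
    by simp
  then show ?thesis
    using assms(4) by (simp add: k coeff_coeff_poly of_nat_poly)
qed

section \<open>Coefficient families: existence, uniqueness and gcds with \<open>N\<close>\<close>

lemma coeff_poly_diff: "coeff_poly m r d - coeff_poly m r e = coeff_poly m r (\<lambda>k. d k - e k)"
  by (intro poly_eqI) (simp add: coeff_coeff_poly)

lemma of_int_mult_coeff_poly: "of_int c * coeff_poly m r d = coeff_poly m r (\<lambda>k. c * d k)"
  by (intro poly_eqI) (simp add: coeff_coeff_poly of_int_poly)

lemma coeff_poly_cong:
  "(\<And>k. k \<in> index_set m r \<Longrightarrow> d k = e k) \<Longrightarrow> coeff_poly m r d = coeff_poly m r e"
  by (intro poly_eqI) (simp add: coeff_coeff_poly)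

lemma coeff_families_bounds:
  assumes "d \<in> coeff_families m r p N" "k \<in> index_set m r" "p > 0" "p dvd N"
  shows "int p dvd d k" "0 \<le> d k" "d k \<le> int N - int p"
proof -
  have "d k \<in> (\<lambda>k. int p * k) ` {0..(int N - int p) div int p}"
    using assms(1,2) unfolding coeff_families_def by (rule PiE_mem)
  then obtain l where l: "d k = int p * l" "0 \<le> l" "l \<le> (int N - int p) div int p"
    by fastforce
  have "int p * l \<le> int p * ((int N - int p) div int p)"
    using l(3) by (intro mult_left_mono) auto
  also have "\<dots> = int N - int p"
    using assms(4) by (intro dvd_mult_div_cancel dvd_diff) auto
  finally show "int p dvd d k" "0 \<le> d k" "d k \<le> int N - int p"
    using l by auto
qed

text \<open>Write \<open>F\<close> as \<open>p\<close> times \<open>E\<close>. Reducing a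
  coefficient of \<open>E\<close> modulo \<open>N div p\<close> changes \<open>p\<close> times it by
  a multiple of \<open>N\<close>, which is invisible modulo the ideal.\<close>

lemma coeff_family_exists:
  assumes "m > 0" "r > 0" "p > 0" "N > 0" "p dvd N" "of_nat p dvd F"
  obtains d where "d \<in> coeff_families m r p N" "ideal_cong (idealJ m r N a) F (coeff_poly m r d)"
proof -
  obtain E where E: "F = of_nat p * E"
    using assms(6) by (elim dvdE)
  obtain M where M: "N = p * M"
    using assms(5) by (elim dvdE)
  obtain e where
    "ideal_cong (ideal_gen {varX ^ m - 1, varX ^ r + varY ^ r - of_int a}) E (coeff_poly m r e)"
    using reduced_representative[OF assms(1,2)] .
  then have "ideal_cong (idealJ m r N a) E (coeff_poly m r e)"
    unfolding ideal_cong_def idealJ_def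
    by (rule rev_subsetD) (intro ideal_gen_mono, auto)
  then have 1: "ideal_cong (idealJ m r N a) F (of_int (int p) * coeff_poly m r e)"
    unfolding E idealJ_def by (simp add: ideal_cong_mult_left)
  \<comment> \<open>The restriction makes the family extensional, as membership in
    \<open>PiE\<close> demands.\<close>
  define d where "d = restrict (\<lambda>k. int p * (e k mod int M)) (index_set m r)"
  have "int p * e k - int p * (e k mod int M) = int N * (e k div int M)" for k
    by (simp add: M minus_mod_eq_mult_div flip: right_diff_distrib)
  then have "coeff_poly m r (\<lambda>k. int p * e k - d k) = coeff_poly m r (\<lambda>k. int N * (e k div int M))"
    by (intro coeff_poly_cong) (simp add: d_def)
  then have "of_int (int p) * coeff_poly m r e - coeff_poly m r d
      = of_int (int N) * coeff_poly m r (\<lambda>k. e k div int M)"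
    unfolding of_int_mult_coeff_poly coeff_poly_diff .
  then have "of_int (int p) * coeff_poly m r e - coeff_poly m r d
      = coeff_poly m r (\<lambda>k. e k div int M) * of_nat N"
    by (simp only: of_int_of_nat_eq mult.commute)
  moreover have "coeff_poly m r (\<lambda>k. e k div int M) * of_nat N \<in> idealJ m r N a"
    unfolding idealJ_def by (intro ideal_gen_mult ideal_gen_base) auto
  ultimately have "ideal_cong (idealJ m r N a) F (coeff_poly m r d)"
    using ideal_cong_trans[OF 1[unfolded idealJ_def], of "coeff_poly m r d"]
    by (simp add: idealJ_def ideal_cong_def)
  \<comment> \<open>Hence the residues modulo \<open>M\<close> are exactly the factors that the
    families allow.\<close>
  moreover have "(int N - int p) div int p = int M - 1"
    using assms(3) by (simp add: M flip: right_diff_distrib')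
  then have "d \<in> coeff_families m r p N"
    using assms(3,4) unfolding coeff_families_def d_def M
    by (intro restrict_PiE_iff[THEN iffD2] ballI imageI) auto
  ultimately show thesis
    using that by blast
qed

text \<open>Corresponding entries differ by a multiple of \<open>N\<close>, but both lie between 0
  and \<open>N - p\<close>.\<close>

lemma coeff_family_unique:
  assumes "m > 0" "r > 0" "p > 0" "p dvd N"
    "d \<in> coeff_families m r p N" "ideal_cong (idealJ m r N a) F (coeff_poly m r d)"
    "e \<in> coeff_families m r p N" "ideal_cong (idealJ m r N a) F (coeff_poly m r e)"
  shows "d = e"
proof (rule PiE_ext)
  fix k assume k: "k \<in> index_set m r"
  have "coeff_poly m r (\<lambda>k. d k - e k) \<in> idealJ m r N a"
    using assms(6,8) ideal_gen_diff[of "F - coeff_poly m r e" _ "F - coeff_poly m r d"]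
    unfolding ideal_cong_def idealJ_def coeff_poly_diff[symmetric] by simp
  then have "int N dvd d k - e k"
    using reduced_in_idealJ_dvd[OF assms(1,2) _ k] by blast
  moreover have "\<bar>d k - e k\<bar> < int N"
    using coeff_families_bounds[OF assms(5) k assms(3,4)]
      coeff_families_bounds[OF assms(7) k assms(3,4)] assms(3) by linarith
  ultimately show "d k = e k"
    using dvd_imp_le_int[of "d k - e k" "int N"] by fastforce
qed (use assms in \<open>auto simp: coeff_families_def\<close>)

text \<open>The gcd is a multiple of \<open>p\<close>, hence not 1, and at most \<open>d k\<close>,
  hence at most \<open>N - p\<close>.\<close>

lemma proper_divisor_gcd:
  assumes "d \<in> coeff_families m r p N" "k \<in> index_set m r" "prime p" "p dvd N" "d k \<noteq> 0"
  shows "proper_divisor (gcd (d k) (int N)) (int N)"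
proof -
  note b = coeff_families_bounds[OF assms(1,2) prime_gt_0_nat[OF assms(3)] assms(4)]
  have "int p dvd gcd (d k) (int N)"
    using b(1) assms(4) by simp
  then have "gcd (d k) (int N) \<noteq> 1"
    using prime_gt_1_nat[OF assms(3)] zdvd_imp_le[of "int p" 1] by fastforce
  moreover have "gcd (d k) (int N) \<le> d k"
    using b(2) assms(5) by (intro gcd_le1_int) auto
  then have "gcd (d k) (int N) \<noteq> int N"
    using b(3) prime_gt_0_nat[OF assms(3)] by linarith
  moreover have "gcd (d k) (int N) > 0"
    using assms(5) by simp
  ultimately show ?thesis
    by (simp add: proper_divisor_def)
qed

section \<open>Reduction modulo the larger ideal\<close>

lemma power_cong_of_power_eq_1:
  assumes "z ^ m - 1 \<in> ideal_gen S"
  shows "ideal_cong (ideal_gen S) (z ^ (m * n + r)) (z ^ r)"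
proof -
  have "ideal_cong (ideal_gen S) ((z ^ m) ^ n) (1 ^ n)"
    using assms by (intro ideal_cong_power) (simp add: ideal_cong_def)
  then have "ideal_cong (ideal_gen S) (z ^ r * (z ^ m) ^ n) (z ^ r * 1)"
    by (intro ideal_cong_mult_left) simp
  then show ?thesis
    by (simp add: power_add power_mult mult.commute)
qed

text \<open>The generator \<open>varY ^ m - 1\<close>, not listed for \<open>idealJ\<close>, enters
  here: it lowers the exponent of \<open>varY\<close> from \<open>p\<close> to
  \<open>r\<close>.\<close>

lemma trinomial_cong_idealI:
  assumes "p = m * n + r" "p dvd N"
  shows "ideal_cong (idealI m r N a)
    ((varX ^ p + varY ^ p + of_int (b + a) ^ p - of_int a) ^ (N div p)) (of_int (b + a) ^ N)"
proof -
  define S where "S = {varX ^ m - 1, varY ^ m - 1, varX ^ r + varY ^ r - of_int a, of_nat N}"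
  have "ideal_cong (ideal_gen S) (varX ^ p + varY ^ p) (varX ^ r + varY ^ r)"
    unfolding assms(1)
    by (intro ideal_cong_add power_cong_of_power_eq_1 ideal_gen_base) (auto simp: S_def)
  moreover have "ideal_cong (ideal_gen S) (varX ^ r + varY ^ r) (of_int a)"
    unfolding ideal_cong_def by (intro ideal_gen_base) (auto simp: S_def)
  ultimately have "ideal_cong (ideal_gen S) (varX ^ p + varY ^ p) (of_int a)"
    by (rule ideal_cong_trans)
  then have "ideal_cong (ideal_gen S)
      (varX ^ p + varY ^ p + of_int (b + a) ^ p - of_int a) (of_int (b + a) ^ p)"
    by (simp add: ideal_cong_def algebra_simps)
  from ideal_cong_power[OF this, of "N div p"] show ?thesis
    using assms(2) by (simp add: idealI_def S_def flip: power_mult)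
qed

theorem proposition4p4:
  fixes N p m n r :: nat and a b :: int
  assumes "N > 0" and "prime p" and "p dvd N"
    and "2 \<le> m" and "m \<le> p - 1"
    and "n > 0" and "r \<in> {1..m - 1}" and "p = m * n + r"
  shows
    "(\<exists>!d. d \<in> coeff_families m r p N \<and>
        ideal_cong (idealJ m r N a)
          ((varX + varY + of_int b) ^ N
            - (varX ^ p + varY ^ p + of_int (b + a) ^ p - of_int a) ^ (N div p))
          (coeff_poly m r d)) \<and>
     (\<forall>d. d \<in> coeff_families m r p N \<and>
        ideal_cong (idealJ m r N a)
          ((varX + varY + of_int b) ^ N
            - (varX ^ p + varY ^ p + of_int (b + a) ^ p - of_int a) ^ (N div p))
          (coeff_poly m r d) \<longrightarrow>
        ideal_cong (idealI m r N a)
          ((varX + varY + of_int b) ^ N - of_int (b + a) ^ N) (coeff_poly m r d) \<and>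
        ((varX + varY + of_int b) ^ N - of_int (b + a) ^ N \<notin> idealI m r N a \<longrightarrow>
          (\<exists>(i0, j0)\<in>index_set m r. d (i0, j0) \<noteq> 0 \<and>
             proper_divisor (gcd (d (i0, j0)) (int N)) (int N))))"
proof -
  let ?G = "(varX ^ p + varY ^ p + of_int (b + a) ^ p - of_int a) ^ (N div p)"
  let ?F = "(varX + varY + of_int b) ^ N - ?G"
  let ?H = "(varX + varY + of_int b) ^ N - of_int (b + a) ^ N"
  have pos: "m > 0" "r > 0" "p > 0"
    using assms prime_gt_0_nat by auto
  have unique: "\<exists>!d. d \<in> coeff_families m r p N \<and> ideal_cong (idealJ m r N a) ?F (coeff_poly m r d)"
    using coeff_family_exists[OF pos assms(1,3) prime_dvd_trinomial_power_diff[OF assms(2,3)]]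
      coeff_family_unique[OF pos assms(3)] by metis
  have congI: "ideal_cong (idealI m r N a) ?H (coeff_poly m r d)"
    if "ideal_cong (idealJ m r N a) ?F (coeff_poly m r d)" for d
  proof -
    have "idealJ m r N a \<subseteq> idealI m r N a"
      unfolding idealI_def idealJ_def by (intro ideal_gen_mono) auto
    then have "ideal_cong (idealI m r N a) ?F (coeff_poly m r d)"
      using that by (auto simp: ideal_cong_def)
    \<comment> \<open>Adding the congruence between \<open>?G\<close> and \<open>(b + a) ^ N\<close>
      cancels \<open>?G\<close> and turns \<open>?F\<close> into \<open>?H\<close>.\<close>
    from ideal_cong_add[OF this[unfolded idealI_def]
        trinomial_cong_idealI[OF assms(8,3), of a b, unfolded idealI_def]]
    show ?thesis
      by (simp add: idealI_def ideal_cong_def diff_diff_eq add.commute)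
  qed
  have "\<exists>(i0, j0)\<in>index_set m r. d (i0, j0) \<noteq> 0 \<and>
      proper_divisor (gcd (d (i0, j0)) (int N)) (int N)"
    if d: "d \<in> coeff_families m r p N" "ideal_cong (idealJ m r N a) ?F (coeff_poly m r d)"
      and H: "?H \<notin> idealI m r N a" for d
  proof -
    \<comment> \<open>Otherwise \<open>?H\<close> would be congruent to 0 and so lie in
      \<open>idealI\<close>.\<close>
    have "coeff_poly m r d \<noteq> 0"
      using congI[OF d(2)] H by (auto simp: ideal_cong_def)
    then obtain k where k: "k \<in> index_set m r" "d k \<noteq> 0"
      unfolding coeff_poly_def by (auto elim!: sum.not_neutral_contains_not_neutral)
    then show ?thesis
      using proper_divisor_gcd[OF d(1) k(1) assms(2,3) k(2)]
      by (auto intro!: bexI[of _ k] split: prod.split)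
  qed
  with unique congI show ?thesis
    by blast
qed

end
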